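(* Let $\psi\in\mathcal{O}_c(\mathbb{R})$, $f\in\mathcal{O}'_c(\mathbb{R})$, and let $\mu_\alpha=\langle f,x^\alpha\rangle$ ($\alpha=0,1,2,\dots$) be the moment sequence of $f$. Then for every fixed $b\in\mathbb{R}$, $$\sqrt{a}\,\Big\langle f(ax),\psi\Big(x-\frac{b}{a}\Big)\Big\rangle\sim\sum_{\alpha=0}^{\infty}\frac{\mu_\alpha\, D^\alpha\psi(-b/a)}{\alpha!\,a^{\alpha+1/2}}\qquad\text{as } a\to\infty.$$
   Context: For $\gamma\in\mathbb{R}$, $\mathcal{O}_\gamma(\mathbb{R})$ is the space of smooth functions $\psi$ on $\mathbb{R}$ such that $D^\alpha\psi(x)=O(|x|^\gamma)$ as $|x|\to\infty$ for every $\alpha\in\mathbb{N}=\{0,1,2,\dots\}$, topologized by the seminorms $\|\psi\|_{\alpha,\gamma}=\sup\{\rho_\gamma(|x|)\,|D^\alpha\psi(x)|:x\in\mathbb{R}\}$, $\alpha\in\mathbb{N}$, where $\rho_\gamma(|x|)=1$ for $0\le|x|\le 1$ and $\rho_\gamma(|x|)=|x|^{-\gamma}$ for $|x|>1$. $\mathcal{O}_c(\mathbb{R})=\bigcup_\gamma\mathcal{O}_\gamma(\mathbb{R})$ with the inductive limit topology, and its dual is $\mathcal{O}'_c(\mathbb{R})=\bigcap_\gamma\mathcal{O}'_\gamma(\mathbb{R})$. $D^\alpha$ is the $\alpha$-th derivative. $\langle\cdot,\cdot\rangle$ is the (bilinear) duality pairing in the variable $x$, and for $a>0$ the dilated distribution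 $f(ax)$ is defined by $\langle f(ax),\phi(x)\rangle=\frac1a\langle f(x),\phi(x/a)\rangle$. The left-hand side is the continuous wavelet transform $(W_\psi f)(a,b)$ of $f$ with respect to $\psi$, formally $\frac{1}{\sqrt a}\int f(x)\,\psi\big(\frac{x-b}{a}\big)\,dx$. The relation $\sim$ means asymptotic expansion with respect to the scale $a^{-\alpha-1/2}$: for every integer $N\ge 0$, the left-hand side minus the sum of the terms with $\alpha\le N$ is $o(a^{-N-1/2})$ as $a\to\infty$ (the coefficients $D^\alpha\psi(-b/a)$ may depend on $a$). *)

theory Defs
  imports "HOL-Analysis.Analysis" "HOL-Library.Landau_Symbols"
begin

definition D :: "nat \<Rightarrow> (real \<Rightarrow> complex) \<Rightarrow> real \<Rightarrow> complex" where
  "D \<alpha> \<psi> = ((\<lambda>g x. vector_derivative g (at x)) ^^ \<alpha>) \<psi>"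

definition smooth :: "(real \<Rightarrow> complex) \<Rightarrow> bool" where
  "smooth \<psi> \<longleftrightarrow> (\<forall>\<alpha> x. D \<alpha> \<psi> differentiable (at x))"

text \<open>On the real line, \<^term>\<open>at_infinity\<close> is the filter \<open>\<bar>x\<bar> \<rightarrow> \<infinity>\<close>.\<close>

definition O_space :: "real \<Rightarrow> (real \<Rightarrow> complex) set" where
  "O_space \<gamma> = {\<psi>. smooth \<psi> \<and>
     (\<forall>\<alpha>. (\<lambda>x. norm (D \<alpha> \<psi> x)) \<in> O[at_infinity](\<lambda>x. \<bar>x\<bar> powr \<gamma>))}"

definition rho :: "real \<Rightarrow> real \<Rightarrow> real" where
  "rho \<gamma> r = (if r \<le> 1 then 1 else r powr (- \<gamma>))"

definition O_seminorm :: "nat \<Rightarrow> real \<Rightarrow> (real \<Rightarrow> complex) \<Rightarrow> real" where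
  "O_seminorm \<alpha> \<gamma> \<psi> = (SUP x. rho \<gamma> \<bar>x\<bar> * norm (D \<alpha> \<psi> x))"

definition O_open :: "real \<Rightarrow> (real \<Rightarrow> complex) set \<Rightarrow> bool" where
  "O_open \<gamma> U \<longleftrightarrow> U \<subseteq> O_space \<gamma> \<and>
     (\<forall>\<phi>\<in>U. \<exists>n. \<exists>\<epsilon>>0. \<forall>\<eta>\<in>O_space \<gamma>.
        (\<forall>\<alpha>\<le>n. O_seminorm \<alpha> \<gamma> (\<lambda>x. \<eta> x - \<phi> x) < \<epsilon>) \<longrightarrow> \<eta> \<in> U)"

definition O_top :: "real \<Rightarrow> (real \<Rightarrow> complex) topology" where
  "O_top \<gamma> = topology (O_open \<gamma>)"

definition Oc :: "(real \<Rightarrow> complex) set" where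
  "Oc = (\<Union>\<gamma>. O_space \<gamma>)"

definition abs_convex :: "(real \<Rightarrow> complex) set \<Rightarrow> bool" where
  "abs_convex V \<longleftrightarrow> (\<forall>\<phi>\<in>V. \<forall>\<eta>\<in>V. \<forall>c d :: complex.
     norm c + norm d \<le> 1 \<longrightarrow> (\<lambda>x. c * \<phi> x + d * \<eta> x) \<in> V)"

text \<open>The (locally convex) inductive limit topology: the neighbourhoods of \<open>0\<close> are generated by the
  absolutely convex \<open>V\<close> whose trace on every \<^term>\<open>O_space \<gamma>\<close> is a neighbourhood of \<open>0\<close> there.\<close>

definition Oc_zero_nbhd :: "(real \<Rightarrow> complex) set \<Rightarrow> bool" where
  "Oc_zero_nbhd V \<longleftrightarrow> V \<subseteq> Oc \<and> abs_convex V \<and>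
     (\<forall>\<gamma>. \<exists>W. openin (O_top \<gamma>) W \<and> (\<lambda>x. 0) \<in> W \<and> W \<subseteq> V)"

definition Oc_open :: "(real \<Rightarrow> complex) set \<Rightarrow> bool" where
  "Oc_open U \<longleftrightarrow> U \<subseteq> Oc \<and>
     (\<forall>\<phi>\<in>U. \<exists>V. Oc_zero_nbhd V \<and> (\<forall>\<eta>\<in>V. (\<lambda>x. \<phi> x + \<eta> x) \<in> U))"

definition Oc_top :: "(real \<Rightarrow> complex) topology" where
  "Oc_top = topology Oc_open"

text \<open>Functionals are total functions on \<^typ>\<open>real \<Rightarrow> complex\<close>, constrained (and only
  meaningful) on the space on which they are required to be linear and continuous.\<close>

definition linear_on_space ::
    "(real \<Rightarrow> complex) set \<Rightarrow> ((real \<Rightarrow> complex) \<Rightarrow> complex) \<Rightarrow> bool" where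
  "linear_on_space S f \<longleftrightarrow> (\<forall>\<phi>\<in>S. \<forall>\<eta>\<in>S. \<forall>c d.
     f (\<lambda>x. c * \<phi> x + d * \<eta> x) = c * f \<phi> + d * f \<eta>)"

definition O_dual :: "real \<Rightarrow> ((real \<Rightarrow> complex) \<Rightarrow> complex) set" where
  "O_dual \<gamma> = {f. linear_on_space (O_space \<gamma>) f \<and> continuous_map (O_top \<gamma>) euclidean f}"

definition Oc_dual :: "((real \<Rightarrow> complex) \<Rightarrow> complex) set" where
  "Oc_dual = {f. linear_on_space Oc f \<and> continuous_map Oc_top euclidean f}"

definition moment :: "((real \<Rightarrow> complex) \<Rightarrow> complex) \<Rightarrow> nat \<Rightarrow> complex" where
  "moment f \<alpha> = f (\<lambda>x. of_real x ^ \<alpha>)"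

text \<open>The distribution \<open>f(ax)\<close>; only meaningful for \<open>a > 0\<close>.\<close>

definition dilate ::
    "real \<Rightarrow> ((real \<Rightarrow> complex) \<Rightarrow> complex) \<Rightarrow> (real \<Rightarrow> complex) \<Rightarrow> complex" where
  "dilate a f \<phi> = (1 / of_real a) * f (\<lambda>x. \<phi> (x / a))"

lemma istopology_O_open: "istopology (O_open \<gamma>)"
  unfolding istopology_def
proof (intro conjI allI impI)
  fix S T assume S: "O_open \<gamma> S" and T: "O_open \<gamma> T"
  show "O_open \<gamma> (S \<inter> T)"
    unfolding O_open_def
  proof (intro conjI ballI)
    show "S \<inter> T \<subseteq> O_space \<gamma>" using S by (auto simp: O_open_def)
    fix \<phi> assume \<phi>: "\<phi> \<in> S \<inter> T"
    obtain n1 e1 where "e1 > 0" and Sn1: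
      "\<And>\<eta>. \<eta>\<in>O_space \<gamma> \<Longrightarrow> (\<forall>\<alpha>\<le>n1. O_seminorm \<alpha> \<gamma> (\<lambda>x. \<eta> x - \<phi> x) < e1) \<Longrightarrow> \<eta> \<in> S"
      using S \<phi> unfolding O_open_def by blast
    obtain n2 e2 where "e2 > 0" and Tn2:
      "\<And>\<eta>. \<eta>\<in>O_space \<gamma> \<Longrightarrow> (\<forall>\<alpha>\<le>n2. O_seminorm \<alpha> \<gamma> (\<lambda>x. \<eta> x - \<phi> x) < e2) \<Longrightarrow> \<eta> \<in> T"
      using T \<phi> unfolding O_open_def by blast
    show "\<exists>n. \<exists>\<epsilon>>0. \<forall>\<eta>\<in>O_space \<gamma>.
        (\<forall>\<alpha>\<le>n. O_seminorm \<alpha> \<gamma> (\<lambda>x. \<eta> x - \<phi> x) < \<epsilon>) \<longrightarrow> \<eta> \<in> S \<inter> T"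
      by (rule exI[of _ "max n1 n2"], rule exI[of _ "min e1 e2"]) (use Sn1 Tn2 \<open>e1 > 0\<close> \<open>e2 > 0\<close> in auto)
  qed
next
  fix K assume K: "\<forall>S\<in>K. O_open \<gamma> S"
  show "O_open \<gamma> (\<Union>K)"
    unfolding O_open_def
  proof (intro conjI ballI)
    show "\<Union>K \<subseteq> O_space \<gamma>" using K by (auto simp: O_open_def)
    fix \<phi> assume "\<phi> \<in> \<Union>K"
    then obtain S where S: "S \<in> K" "\<phi> \<in> S" by blast
    then obtain n e where "e > 0"
      "\<forall>\<eta>\<in>O_space \<gamma>. (\<forall>\<alpha>\<le>n. O_seminorm \<alpha> \<gamma> (\<lambda>x. \<eta> x - \<phi> x) < e) \<longrightarrow> \<eta> \<in> S"
      using K unfolding O_open_def by meson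
    with S show "\<exists>n. \<exists>\<epsilon>>0. \<forall>\<eta>\<in>O_space \<gamma>.
        (\<forall>\<alpha>\<le>n. O_seminorm \<alpha> \<gamma> (\<lambda>x. \<eta> x - \<phi> x) < \<epsilon>) \<longrightarrow> \<eta> \<in> \<Union>K" by blast
  qed
qed

lemma openin_O_top: "openin (O_top \<gamma>) U \<longleftrightarrow> O_open \<gamma> U"
  unfolding O_top_def using istopology_O_open topology_inverse' by metis

lemma topspace_O_top: "topspace (O_top \<gamma>) = O_space \<gamma>"
proof -
  have "O_open \<gamma> (O_space \<gamma>)" unfolding O_open_def by (auto intro: exI[of _ 1])
  then show ?thesis unfolding topspace_def openin_O_top by (auto simp: O_open_def)
qed

lemma abs_convex_Int: "abs_convex V \<Longrightarrow> abs_convex W \<Longrightarrow> abs_convex (V \<inter> W)"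
  unfolding abs_convex_def by blast

lemma istopology_Oc_open: "istopology Oc_open"
  unfolding istopology_def
proof (intro conjI allI impI)
  fix S T assume S: "Oc_open S" and T: "Oc_open T"
  show "Oc_open (S \<inter> T)"
    unfolding Oc_open_def
  proof (intro conjI ballI)
    show "S \<inter> T \<subseteq> Oc" using S by (auto simp: Oc_open_def)
    fix \<phi> assume \<phi>: "\<phi> \<in> S \<inter> T"
    obtain V where V: "Oc_zero_nbhd V" "\<forall>\<eta>\<in>V. (\<lambda>x. \<phi> x + \<eta> x) \<in> S"
      using S \<phi> unfolding Oc_open_def by blast
    obtain W where W: "Oc_zero_nbhd W" "\<forall>\<eta>\<in>W. (\<lambda>x. \<phi> x + \<eta> x) \<in> T"
      using T \<phi> unfolding Oc_open_def by blast
    have "\<exists>X. openin (O_top \<gamma>) X \<and> (\<lambda>x. 0) \<in> X \<and> X \<subseteq> V \<inter> W" for \<gamma>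
    proof -
      obtain X Y where "openin (O_top \<gamma>) X" "(\<lambda>x. 0) \<in> X" "X \<subseteq> V"
        "openin (O_top \<gamma>) Y" "(\<lambda>x. 0) \<in> Y" "Y \<subseteq> W"
        using V(1) W(1) unfolding Oc_zero_nbhd_def by meson
      then show ?thesis by (intro exI[of _ "X \<inter> Y"]) auto
    qed
    then have "Oc_zero_nbhd (V \<inter> W)"
      using V(1) W(1) abs_convex_Int unfolding Oc_zero_nbhd_def by blast
    with V W show "\<exists>V. Oc_zero_nbhd V \<and> (\<forall>\<eta>\<in>V. (\<lambda>x. \<phi> x + \<eta> x) \<in> S \<inter> T)"
      by (intro exI[of _ "V \<inter> W"]) auto
  qed
next
  fix K assume K: "\<forall>S\<in>K. Oc_open S"
  show "Oc_open (\<Union>K)"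
    unfolding Oc_open_def
  proof (intro conjI ballI)
    show "\<Union>K \<subseteq> Oc" using K by (auto simp: Oc_open_def)
    fix \<phi> assume "\<phi> \<in> \<Union>K"
    then obtain S where S: "S \<in> K" "\<phi> \<in> S" by blast
    then obtain V where "Oc_zero_nbhd V" "\<forall>\<eta>\<in>V. (\<lambda>x. \<phi> x + \<eta> x) \<in> S"
      using K unfolding Oc_open_def by meson
    with S show "\<exists>V. Oc_zero_nbhd V \<and> (\<forall>\<eta>\<in>V. (\<lambda>x. \<phi> x + \<eta> x) \<in> \<Union>K)" by blast
  qed
qed

lemma openin_Oc_top: "openin Oc_top U \<longleftrightarrow> Oc_open U"
  unfolding Oc_top_def using istopology_Oc_open topology_inverse' by metis

lemma D_lincomb:
  assumes "smooth \<phi>" "smooth \<eta>"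
  shows "D \<alpha> (\<lambda>x. c * \<phi> x + d * \<eta> x) = (\<lambda>x. c * D \<alpha> \<phi> x + d * D \<alpha> \<eta> x)"
proof (induction \<alpha>)
  case 0
  then show ?case by (simp add: D_def)
next
  case (Suc \<alpha>)
  have S: "D (Suc \<alpha>) g = (\<lambda>x. vector_derivative (D \<alpha> g) (at x))" for g
    by (simp add: D_def)
  have "(D \<alpha> g has_vector_derivative D (Suc \<alpha>) g x) (at x)" if "smooth g" for g x
    using that unfolding S smooth_def by (simp add: vector_derivative_works [symmetric])
  then have "((\<lambda>x. c * D \<alpha> \<phi> x + d * D \<alpha> \<eta> x) has_vector_derivative
      (c * D (Suc \<alpha>) \<phi> x + d * D (Suc \<alpha>) \<eta> x)) (at x)" for x
    using assms by (auto intro!: derivative_intros)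
  then show ?case
    unfolding S[of "\<lambda>x. c * \<phi> x + d * \<eta> x"] Suc.IH by (auto intro!: vector_derivative_at)
qed

lemma O_space_lincomb:
  assumes "\<phi> \<in> O_space \<gamma>" "\<eta> \<in> O_space \<gamma>"
  shows "(\<lambda>x. c * \<phi> x + d * \<eta> x) \<in> O_space \<gamma>"
proof -
  have sm: "smooth \<phi>" "smooth \<eta>" using assms by (auto simp: O_space_def)
  note D = D_lincomb[OF sm]
  have "smooth (\<lambda>x. c * \<phi> x + d * \<eta> x)"
    using sm unfolding smooth_def D by (auto intro!: derivative_intros)
  moreover have "(\<lambda>x. norm (c * D \<alpha> \<phi> x + d * D \<alpha> \<eta> x)) \<in> O[at_infinity](\<lambda>x. \<bar>x\<bar> powr \<gamma>)" for \<alpha>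
  proof -
    have "(\<lambda>x. norm c * norm (D \<alpha> \<phi> x) + norm d * norm (D \<alpha> \<eta> x)) \<in> O[at_infinity](\<lambda>x. \<bar>x\<bar> powr \<gamma>)"
      using assms by (intro sum_in_bigo) (auto simp: O_space_def)
    moreover have "(\<lambda>x. norm (c * D \<alpha> \<phi> x + d * D \<alpha> \<eta> x)) \<in>
        O[at_infinity](\<lambda>x. norm c * norm (D \<alpha> \<phi> x) + norm d * norm (D \<alpha> \<eta> x))"
    proof (intro landau_o.big_mono always_eventually allI)
      fix x
      have "norm (c * D \<alpha> \<phi> x + d * D \<alpha> \<eta> x) \<le> norm c * norm (D \<alpha> \<phi> x) + norm d * norm (D \<alpha> \<eta> x)"
        by (metis norm_mult norm_triangle_ineq)
      then show "norm (norm (c * D \<alpha> \<phi> x + d * D \<alpha> \<eta> x))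
          \<le> norm (norm c * norm (D \<alpha> \<phi> x) + norm d * norm (D \<alpha> \<eta> x))" by simp
    qed
    ultimately show ?thesis by (rule landau_o.big_trans[rotated])
  qed
  ultimately show ?thesis by (simp add: O_space_def D)
qed

lemma O_space_mono:
  assumes "\<gamma> \<le> \<gamma>'"
  shows "O_space \<gamma> \<subseteq> O_space \<gamma>'"
proof -
  have "eventually (\<lambda>x::real. \<bar>x\<bar> \<ge> 1) at_infinity"
    by (auto simp: eventually_at_infinity)
  then have "(\<lambda>x::real. \<bar>x\<bar> powr \<gamma>) \<in> O[at_infinity](\<lambda>x. \<bar>x\<bar> powr \<gamma>')"
    using assms by (intro landau_o.big_mono) (auto elim!: eventually_mono intro!: powr_mono)
  then show ?thesis unfolding O_space_def using landau_o.big_trans by blast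
qed

lemma Oc_common:
  assumes "\<phi> \<in> Oc" "\<eta> \<in> Oc"
  obtains \<gamma> where "\<phi> \<in> O_space \<gamma>" "\<eta> \<in> O_space \<gamma>"
proof -
  obtain g h where "\<phi> \<in> O_space g" "\<eta> \<in> O_space h" using assms by (auto simp: Oc_def)
  then show ?thesis
    using that[of "max g h"] O_space_mono[of g "max g h"] O_space_mono[of h "max g h"] by auto
qed

lemma Oc_lincomb: "\<phi> \<in> Oc \<Longrightarrow> \<eta> \<in> Oc \<Longrightarrow> (\<lambda>x. c * \<phi> x + d * \<eta> x) \<in> Oc"
  by (erule (1) Oc_common) (auto simp: Oc_def intro: O_space_lincomb)

lemma zero_in_O_space: "(\<lambda>x. 0) \<in> O_space \<gamma>"
proof -
  have "D \<alpha> (\<lambda>x. 0) = (\<lambda>x. 0)" for \<alpha>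
    by (induction \<alpha>) (auto simp: D_def)
  then show ?thesis by (simp add: O_space_def smooth_def)
qed

lemma topspace_Oc_top: "topspace Oc_top = Oc"
proof -
  have "Oc_zero_nbhd Oc"
    unfolding Oc_zero_nbhd_def abs_convex_def
    using Oc_lincomb zero_in_O_space openin_topspace[of "O_top _"]
    by (auto simp: topspace_O_top Oc_def intro!: exI[of _ "O_space _"])
  then have "Oc_open Oc"
    unfolding Oc_open_def using Oc_lincomb[where c = 1 and d = 1] by auto
  then show ?thesis unfolding topspace_def openin_Oc_top by (auto simp: Oc_open_def)
qed

theorem Oc_dual_eq_Inter: "Oc_dual = (\<Inter>\<gamma>. O_dual \<gamma>)"
proof (intro equalityI subsetI)
  fix f assume f: "f \<in> Oc_dual"
  have "continuous_map (O_top \<gamma>) euclidean f" for \<gamma>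
    unfolding continuous_map_def topspace_O_top openin_O_top
  proof (intro conjI allI impI)
    show "f \<in> O_space \<gamma> \<rightarrow> topspace euclidean" by auto
    fix U :: "complex set" assume U: "openin euclidean U"
    have Uc: "Oc_open {\<phi> \<in> Oc. f \<phi> \<in> U}"
      using f U unfolding Oc_dual_def continuous_map_def topspace_Oc_top openin_Oc_top by blast
    show "O_open \<gamma> {\<phi> \<in> O_space \<gamma>. f \<phi> \<in> U}"
      unfolding O_open_def
    proof (intro conjI ballI)
      show "{\<phi> \<in> O_space \<gamma>. f \<phi> \<in> U} \<subseteq> O_space \<gamma>" by auto
      fix \<phi> assume \<phi>: "\<phi> \<in> {\<phi> \<in> O_space \<gamma>. f \<phi> \<in> U}"
      then have "\<phi> \<in> {\<phi> \<in> Oc. f \<phi> \<in> U}" by (auto simp: Oc_def)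
      then obtain V where V: "Oc_zero_nbhd V"
        "\<forall>\<eta>\<in>V. (\<lambda>x. \<phi> x + \<eta> x) \<in> {\<phi> \<in> Oc. f \<phi> \<in> U}"
        using Uc unfolding Oc_open_def by blast
      then obtain W where W: "O_open \<gamma> W" "(\<lambda>x. 0) \<in> W" "W \<subseteq> V"
        unfolding Oc_zero_nbhd_def openin_O_top by meson
      then obtain n e where e: "e > 0"
        "\<forall>\<eta>\<in>O_space \<gamma>. (\<forall>\<alpha>\<le>n. O_seminorm \<alpha> \<gamma> (\<lambda>x. \<eta> x - 0) < e) \<longrightarrow> \<eta> \<in> W"
        unfolding O_open_def by meson
      have "f \<eta> \<in> U" if \<eta>: "\<eta> \<in> O_space \<gamma>"
        "\<forall>\<alpha>\<le>n. O_seminorm \<alpha> \<gamma> (\<lambda>x. \<eta> x - \<phi> x) < e" for \<eta>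
      proof -
        have "(\<lambda>x. \<eta> x - \<phi> x) \<in> O_space \<gamma>"
          using O_space_lincomb[of \<eta> \<gamma> \<phi> 1 "-1"] \<eta> \<phi> by simp
        with e(2) \<eta>(2) have "(\<lambda>x. \<eta> x - \<phi> x) \<in> W" by simp
        with W(3) have "(\<lambda>x. \<eta> x - \<phi> x) \<in> V" by blast
        from bspec[OF V(2) this]
        show ?thesis by simp
      qed
      with e(1) show "\<exists>n. \<exists>\<epsilon>>0. \<forall>\<eta>\<in>O_space \<gamma>.
          (\<forall>\<alpha>\<le>n. O_seminorm \<alpha> \<gamma> (\<lambda>x. \<eta> x - \<phi> x) < \<epsilon>) \<longrightarrow>
          \<eta> \<in> {\<phi> \<in> O_space \<gamma>. f \<phi> \<in> U}"
        by blast
    qed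
  qed
  moreover have "linear_on_space (O_space \<gamma>) f" for \<gamma>
    using f unfolding Oc_dual_def linear_on_space_def Oc_def by blast
  ultimately show "f \<in> (\<Inter>\<gamma>. O_dual \<gamma>)" by (auto simp: O_dual_def)
next
  fix f assume f: "f \<in> (\<Inter>\<gamma>. O_dual \<gamma>)"
  have lin: "f (\<lambda>x. c * \<phi> x + d * \<eta> x) = c * f \<phi> + d * f \<eta>"
    if "\<phi> \<in> Oc" "\<eta> \<in> Oc" for \<phi> \<eta> c d
    using that
  proof (rule Oc_common)
    fix \<gamma> assume "\<phi> \<in> O_space \<gamma>" "\<eta> \<in> O_space \<gamma>"
    moreover have "f \<in> O_dual \<gamma>" using f by blast
    ultimately show ?thesis by (simp add: O_dual_def linear_on_space_def)
  qed
  have zero: "(\<lambda>x. 0) \<in> Oc" using zero_in_O_space by (auto simp: Oc_def)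
  have f0: "f (\<lambda>x. 0) = 0" using lin[OF zero zero, of 0 0] by simp
  have nb: "Oc_zero_nbhd {\<eta> \<in> Oc. norm (f \<eta>) < e}" if "e > 0" for e
    unfolding Oc_zero_nbhd_def
  proof (intro conjI allI)
    show "abs_convex {\<eta> \<in> Oc. norm (f \<eta>) < e}"
      unfolding abs_convex_def
    proof (intro ballI allI impI)
      fix \<phi> \<eta> and c d :: complex
      assume \<phi>: "\<phi> \<in> {\<eta> \<in> Oc. norm (f \<eta>) < e}" and \<eta>: "\<eta> \<in> {\<eta> \<in> Oc. norm (f \<eta>) < e}"
        and cd: "norm c + norm d \<le> 1"
      define m where "m = max (norm (f \<phi>)) (norm (f \<eta>))"
      have m: "0 \<le> m" "m < e" using \<phi> \<eta> by (auto simp: m_def le_max_iff_disj)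
      have "norm (c * f \<phi> + d * f \<eta>) \<le> norm c * norm (f \<phi>) + norm d * norm (f \<eta>)"
        by (metis norm_mult norm_triangle_ineq)
      also have "\<dots> \<le> norm c * m + norm d * m"
        by (intro add_mono mult_left_mono) (auto simp: m_def)
      also have "\<dots> = (norm c + norm d) * m" by (simp add: algebra_simps)
      also have "\<dots> \<le> m" using cd m mult_right_mono[of "norm c + norm d" 1 m] by simp
      also have "\<dots> < e" by (rule m)
      finally show "(\<lambda>x. c * \<phi> x + d * \<eta> x) \<in> {\<eta> \<in> Oc. norm (f \<eta>) < e}"
        using \<phi> \<eta> lin Oc_lincomb by simp
    qed
    fix \<gamma>
    have "continuous_map (O_top \<gamma>) euclidean f" using f by (auto simp: O_dual_def)
    then have "openin (O_top \<gamma>) {\<eta> \<in> topspace (O_top \<gamma>). f \<eta> \<in> ball 0 e}"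
      by (rule openin_continuous_map_preimage) auto
    with that f0 zero_in_O_space
    show "\<exists>W. openin (O_top \<gamma>) W \<and> (\<lambda>x. 0) \<in> W \<and> W \<subseteq> {\<eta> \<in> Oc. norm (f \<eta>) < e}"
      by (intro exI[of _ "{\<eta> \<in> topspace (O_top \<gamma>). f \<eta> \<in> ball 0 e}"])
         (auto simp: topspace_O_top Oc_def)
  qed auto
  have "continuous_map Oc_top euclidean f"
    unfolding continuous_map_def topspace_Oc_top openin_Oc_top
  proof (intro conjI allI impI)
    fix U :: "complex set" assume "openin euclidean U"
    then have U: "open U" by simp
    show "Oc_open {\<phi> \<in> Oc. f \<phi> \<in> U}"
      unfolding Oc_open_def
    proof (intro conjI ballI)
      fix \<phi> assume \<phi>: "\<phi> \<in> {\<phi> \<in> Oc. f \<phi> \<in> U}"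
      then obtain e where e: "e > 0" "ball (f \<phi>) e \<subseteq> U"
        using U open_contains_ball by blast
      have "(\<lambda>x. \<phi> x + \<eta> x) \<in> {\<phi> \<in> Oc. f \<phi> \<in> U}" if "\<eta> \<in> {\<eta> \<in> Oc. norm (f \<eta>) < e}" for \<eta>
        using that \<phi> e lin[of \<phi> \<eta> 1 1] Oc_lincomb[of \<phi> \<eta> 1 1]
        by (auto simp: subset_iff dist_norm)
      with nb[OF e(1)]
      show "\<exists>V. Oc_zero_nbhd V \<and> (\<forall>\<eta>\<in>V. (\<lambda>x. \<phi> x + \<eta> x) \<in> {\<phi> \<in> Oc. f \<phi> \<in> U})"
        by blast
    qed auto
  qed auto
  with lin show "f \<in> Oc_dual" by (simp add: Oc_dual_def linear_on_space_def)
qed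

end

theory Submission
  imports Defs
begin

text \<open>
  Put \<open>t = -b/a\<close>. Up to the factor \<open>a\<^sup>-\<^sup>1\<^sup>/\<^sup>2\<close>, the transform is \<open>f\<close> applied to the function
  \<open>x \<mapsto> \<psi>(t + x/a)\<close>, and the partial sum of the expansion is \<open>f\<close> applied to the Taylor polynomial of
  that function in \<open>x/a\<close>, because \<open>f\<close> sends \<open>x\<^sup>\<alpha>\<close> to the moment \<open>\<mu>\<^sub>\<alpha>\<close>. So everything
  reduces to bounding \<open>f\<close> on the Taylor remainder \<open>R\<^sub>a(x)\<close> by a multiple of \<open>a\<^sup>-\<^sup>M\<close>, where
  \<open>M = N + 1\<close>.

  A continuous functional on one space \<open>O\<^sub>\<gamma>\<close> is controlled by finitely many weighted suprema of
  derivatives (\<open>O_dual_bounded\<close>), so it suffices that every derivative of \<open>R\<^sub>a\<close> is at most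
  \<open>K a\<^sup>-\<^sup>M (2 + \<bar>x\<bar>)\<^sup>\<gamma>\<close> for some \<open>\<gamma>\<close>, uniformly in \<open>a\<close> (\<open>D_scaled_taylor_rem_le\<close>). The exponent
  \<open>\<gamma>\<close> is at our disposal because \<open>f\<close> is continuous on all the spaces; the choice \<open>\<gamma> = M + g\<close>
  leaves room for the factor \<open>\<bar>x\<bar>\<^sup>M\<close> of the remainder and for the growth \<open>\<bar>x\<bar>\<^sup>g\<close> of \<open>\<psi>\<close> and its
  derivatives. The \<open>\<beta>\<close>-th derivative of \<open>R\<^sub>a\<close> is \<open>a\<^sup>-\<^sup>\<beta>\<close> times the remainder of order \<open>M - \<beta>\<close> of the
  \<open>\<beta>\<close>-th derivative of \<open>\<psi>\<close>: for \<open>\<beta> \<le> M\<close> it gains \<open>a\<^sup>-\<^sup>\<beta>\<close> from the dilation and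
  \<open>a\<^sup>-\<^sup>(\<^sup>M\<^sup>-\<^sup>\<beta>\<^sup>)\<close> from Taylor's theorem, and for \<open>\<beta> > M\<close> the dilation alone is enough.
\<close>

section \<open>Iterated derivatives\<close>

lemma D_0 [simp]: "D 0 \<phi> = \<phi>"
  by (simp add: D_def)

lemma D_D: "D m (D n \<phi>) = D (m + n) \<phi>"
  by (simp add: D_def funpow_add)

lemma D_Suc: "D (Suc n) \<phi> = (\<lambda>x. vector_derivative (D n \<phi>) (at x))"
  by (simp add: D_def)

lemma smooth_D: "smooth \<phi> \<Longrightarrow> smooth (D n \<phi>)"
  by (simp add: smooth_def D_D)

lemma smooth_has_vector_derivative:
  assumes "smooth \<phi>"
  shows "(D n \<phi> has_vector_derivative D (Suc n) \<phi> x) (at x)"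
  using assms unfolding D_Suc smooth_def by (simp add: vector_derivative_works [symmetric])

text \<open>For dilations, Taylor remainders and monomials all derivatives can be guessed in closed form;
  this rule turns such a guess into smoothness and the values of \<open>D\<close> at once.\<close>

lemma D_eqI:
  assumes "G 0 = \<phi>" "\<And>n x. (G n has_vector_derivative G (Suc n) x) (at x)"
  shows "D n \<phi> = G n" "smooth \<phi>"
proof -
  show D: "D n \<phi> = G n" for n
  proof (induction n)
    case (Suc n)
    then show ?case
      using assms(2) by (auto simp: D_Suc intro!: vector_derivative_at)
  qed (simp add: assms(1))
  show "smooth \<phi>"
    unfolding smooth_def D using assms(2) by (auto intro: differentiableI_vector)
qed

lemma
  fixes c :: real
  assumes "smooth \<phi>"
  shows D_dilation: "D n (\<lambda>x. \<phi> (c * x)) = (\<lambda>x. of_real c ^ n * D n \<phi> (c * x))"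
    and smooth_dilation: "smooth (\<lambda>x. \<phi> (c * x))"
proof -
  define G where "G n x = of_real c ^ n * D n \<phi> (c * x)" for n x
  have "(G n has_vector_derivative G (Suc n) x) (at x)" for n x
  proof -
    have "((\<lambda>x. c * x) has_vector_derivative c) (at x)"
      by (auto intro!: derivative_eq_intros)
    from vector_diff_chain_at[OF this smooth_has_vector_derivative[OF assms]]
    have "((\<lambda>x. D n \<phi> (c * x)) has_vector_derivative c *\<^sub>R D (Suc n) \<phi> (c * x)) (at x)"
      by (simp add: o_def)
    then show ?thesis
      unfolding G_def
      by (auto intro!: derivative_eq_intros simp: scaleR_conv_of_real mult_ac)
  qed
  moreover have "G 0 = (\<lambda>x. \<phi> (c * x))"
    by (simp add: G_def fun_eq_iff)
  ultimately have "D n (\<lambda>x. \<phi> (c * x)) = G n" "smooth (\<lambda>x. \<phi> (c * x))"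
    using D_eqI[of G] by blast+
  then show "D n (\<lambda>x. \<phi> (c * x)) = (\<lambda>x. of_real c ^ n * D n \<phi> (c * x))"
    "smooth (\<lambda>x. \<phi> (c * x))"
    by (auto simp: G_def)
qed

section \<open>Growth bounds and the continuity estimate\<close>

lemma rho_mult_power_le:
  assumes "0 \<le> r"
  shows "rho (real g) r * (2 + r) ^ g \<le> 3 ^ g"
proof (cases "r \<le> 1")
  case True
  then show ?thesis using assms by (simp add: rho_def power_mono)
next
  case False
  have "(2 + r) ^ g \<le> (3 * r) ^ g"
    using False by (intro power_mono) auto
  then have "rho (real g) r * (2 + r) ^ g \<le> rho (real g) r * (3 * r) ^ g"
    using False by (intro mult_left_mono) (auto simp: rho_def)
  also have "\<dots> = 3 ^ g"
    using False by (simp add: rho_def powr_minus powr_realpow power_mult_distrib)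
  finally show ?thesis .
qed

lemma O_spaceI:
  assumes "smooth \<phi>" "\<And>n x. norm (D n \<phi> x) \<le> K n * (2 + \<bar>x\<bar>) ^ g"
  shows "\<phi> \<in> O_space (real g)"
proof -
  have "(\<lambda>x. norm (D n \<phi> x)) \<in> O[at_infinity](\<lambda>x. \<bar>x\<bar> powr real g)" for n
  proof (rule landau_o.bigI[where c = "\<bar>K n\<bar> * 3 ^ g + 1"])
    show "eventually (\<lambda>x. norm (norm (D n \<phi> x)) \<le> (\<bar>K n\<bar> * 3 ^ g + 1) * norm (\<bar>x\<bar> powr real g)) at_infinity"
      unfolding eventually_at_infinity
    proof (intro exI[of _ 1] allI impI)
      fix x :: real assume x: "1 \<le> norm x"
      have "norm (D n \<phi> x) \<le> \<bar>K n\<bar> * (2 + \<bar>x\<bar>) ^ g"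
        using assms(2)[of n x] by (rule order_trans) (auto intro!: mult_right_mono)
      also have "\<dots> \<le> \<bar>K n\<bar> * (3 * \<bar>x\<bar>) ^ g"
        using x by (intro mult_left_mono power_mono) auto
      also have "\<dots> \<le> (\<bar>K n\<bar> * 3 ^ g + 1) * \<bar>x\<bar> ^ g"
        by (simp add: power_mult_distrib algebra_simps)
      finally show "norm (norm (D n \<phi> x)) \<le> (\<bar>K n\<bar> * 3 ^ g + 1) * norm (\<bar>x\<bar> powr real g)"
        using x by (simp add: powr_realpow)
    qed
  qed (auto intro: add_nonneg_pos)
  then show ?thesis using assms(1) by (auto simp: O_space_def)
qed

text \<open>The growth condition constrains a derivative only near infinity; on the remaining compact
  interval the derivative is bounded by continuity.\<close>

lemma O_space_bound:
  assumes "\<phi> \<in> O_space (real g)"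
  obtains C where "C \<ge> 0" "\<And>x. norm (D n \<phi> x) \<le> C * (1 + \<bar>x\<bar>) ^ g"
proof -
  have "(\<lambda>x. norm (D n \<phi> x)) \<in> O[at_infinity](\<lambda>x. \<bar>x\<bar> powr real g)"
    using assms by (auto simp: O_space_def)
  then obtain c where c: "c > 0"
    "eventually (\<lambda>x. norm (norm (D n \<phi> x)) \<le> c * norm (\<bar>x\<bar> powr real g)) at_infinity"
    by (elim landau_o.bigE)
  then obtain r where r: "\<And>x. r \<le> \<bar>x\<bar> \<Longrightarrow> norm (D n \<phi> x) \<le> c * (\<bar>x\<bar> powr real g)"
    unfolding eventually_at_infinity by auto
  have "continuous_on {- \<bar>r\<bar> - 1..\<bar>r\<bar> + 1} (D n \<phi>)"
    using assms unfolding O_space_def smooth_def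
    by (auto intro!: continuous_at_imp_continuous_on differentiable_imp_continuous_within)
  then have "bounded (D n \<phi> ` {- \<bar>r\<bar> - 1..\<bar>r\<bar> + 1})"
    by (intro compact_imp_bounded compact_continuous_image) auto
  then obtain B where B: "\<And>x. \<bar>x\<bar> \<le> \<bar>r\<bar> + 1 \<Longrightarrow> norm (D n \<phi> x) \<le> B"
    unfolding bounded_iff by force
  show ?thesis
  proof (rule that[of "max c \<bar>B\<bar>"])
    fix x :: real
    show "norm (D n \<phi> x) \<le> max c \<bar>B\<bar> * (1 + \<bar>x\<bar>) ^ g"
    proof (cases "\<bar>x\<bar> \<le> \<bar>r\<bar> + 1")
      case True
      have "norm (D n \<phi> x) \<le> max c \<bar>B\<bar> * 1"
        using B[OF True] by linarith
      also have "\<dots> \<le> max c \<bar>B\<bar> * (1 + \<bar>x\<bar>) ^ g"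
        by (intro mult_left_mono one_le_power) (auto simp: le_max_iff_disj)
      finally show ?thesis .
    next
      case False
      then have "norm (D n \<phi> x) \<le> c * \<bar>x\<bar> ^ g"
        using r[of x] by (simp add: powr_realpow)
      also have "\<dots> \<le> max c \<bar>B\<bar> * (1 + \<bar>x\<bar>) ^ g"
        using c(1) by (intro mult_mono power_mono) auto
      finally show ?thesis .
    qed
  qed (auto simp: le_max_iff_disj)
qed

lemma Oc_bound:
  assumes "\<phi> \<in> Oc"
  obtains g C where "smooth \<phi>" "\<And>n. C n \<ge> 0"
    "\<And>n x. norm (D n \<phi> x) \<le> C n * (1 + \<bar>x\<bar>) ^ g"
proof -
  obtain \<gamma> where "\<phi> \<in> O_space \<gamma>"
    using assms by (auto simp: Oc_def)
  moreover have "\<gamma> \<le> real (nat \<lceil>\<gamma>\<rceil>)"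
    by linarith
  ultimately have *: "\<phi> \<in> O_space (real (nat \<lceil>\<gamma>\<rceil>))"
    using O_space_mono by blast
  then have "\<forall>n. \<exists>C\<ge>0. \<forall>x. norm (D n \<phi> x) \<le> C * (1 + \<bar>x\<bar>) ^ nat \<lceil>\<gamma>\<rceil>"
    by (metis O_space_bound)
  then obtain C where "\<And>n. C n \<ge> 0" "\<And>n x. norm (D n \<phi> x) \<le> C n * (1 + \<bar>x\<bar>) ^ nat \<lceil>\<gamma>\<rceil>"
    by metis
  with * that show ?thesis by (auto simp: O_space_def)
qed

text \<open>A neighbourhood of zero on which \<open>f\<close> is smaller than 1 is described by finitely many
  seminorms; scaling a function into it turns this into a linear bound. The bound on the seminorms
  is stated pointwise, which avoids the supremum, and for positive \<open>K\<close>, so that one may divide by it.\<close>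

lemma O_dual_bounded:
  assumes "f \<in> O_dual \<gamma>"
  obtains n C where "\<And>\<phi> K. \<phi> \<in> O_space \<gamma> \<Longrightarrow> K > 0 \<Longrightarrow>
    (\<And>\<alpha> x. \<alpha> \<le> n \<Longrightarrow> rho \<gamma> \<bar>x\<bar> * norm (D \<alpha> \<phi> x) \<le> K) \<Longrightarrow> norm (f \<phi>) \<le> C * K"
proof -
  have cont: "continuous_map (O_top \<gamma>) euclidean f" and lin: "linear_on_space (O_space \<gamma>) f"
    using assms by (auto simp: O_dual_def)
  have f_scale: "f (\<lambda>x. c * \<phi> x) = c * f \<phi>" if "\<phi> \<in> O_space \<gamma>" for c \<phi>
    using lin[unfolded linear_on_space_def, rule_format, OF that that, of c 0] by simp
  have f0: "f (\<lambda>x. 0) = 0"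
    using f_scale[OF zero_in_O_space, of 0] by simp
  have "openin (O_top \<gamma>) {\<phi> \<in> topspace (O_top \<gamma>). f \<phi> \<in> ball 0 1}"
    by (rule openin_continuous_map_preimage[OF cont]) auto
  then have "O_open \<gamma> {\<phi> \<in> O_space \<gamma>. norm (f \<phi>) < 1}"
    by (simp add: openin_O_top topspace_O_top)
  moreover have "(\<lambda>x. 0) \<in> {\<phi> \<in> O_space \<gamma>. norm (f \<phi>) < 1}"
    using zero_in_O_space f0 by simp
  ultimately obtain n e where e: "e > 0"
    "\<forall>\<eta>\<in>O_space \<gamma>. (\<forall>\<alpha>\<le>n. O_seminorm \<alpha> \<gamma> (\<lambda>x. \<eta> x - 0) < e) \<longrightarrow>
      \<eta> \<in> {\<phi> \<in> O_space \<gamma>. norm (f \<phi>) < 1}"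
    unfolding O_open_def by meson
  show ?thesis
  proof (rule that[of n "2 / e"])
    fix \<phi> and K :: real
    assume \<phi>: "\<phi> \<in> O_space \<gamma>" and K: "K > 0"
      and bd: "\<And>\<alpha> x. \<alpha> \<le> n \<Longrightarrow> rho \<gamma> \<bar>x\<bar> * norm (D \<alpha> \<phi> x) \<le> K"
    define s where "s = e / (2 * K)"
    have s: "s > 0" using e K by (simp add: s_def)
    have sm: "smooth \<phi>" using \<phi> by (simp add: O_space_def)
    have D: "D \<alpha> (\<lambda>x. of_real s * \<phi> x) x = of_real s * D \<alpha> \<phi> x" for \<alpha> x
      using D_lincomb[OF sm sm, of \<alpha> "of_real s" 0] by simp
    have "O_seminorm \<alpha> \<gamma> (\<lambda>x. of_real s * \<phi> x) < e" if "\<alpha> \<le> n" for \<alpha>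
    proof -
      have "O_seminorm \<alpha> \<gamma> (\<lambda>x. of_real s * \<phi> x) \<le> e / 2"
        unfolding O_seminorm_def
      proof (rule cSUP_least)
        fix x :: real
        have "rho \<gamma> \<bar>x\<bar> * norm (D \<alpha> (\<lambda>x. of_real s * \<phi> x) x) = s * (rho \<gamma> \<bar>x\<bar> * norm (D \<alpha> \<phi> x))"
          using s by (simp add: D norm_mult)
        also have "\<dots> \<le> s * K"
          using s bd[OF that] by (intro mult_left_mono) auto
        finally show "rho \<gamma> \<bar>x\<bar> * norm (D \<alpha> (\<lambda>x. of_real s * \<phi> x) x) \<le> e / 2"
          using K by (simp add: s_def)
      qed simp
      with e(1) show ?thesis by linarith
    qed
    moreover have "(\<lambda>x. of_real s * \<phi> x) \<in> O_space \<gamma>"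
      using O_space_lincomb[OF \<phi> \<phi>, of "of_real s" 0] by simp
    ultimately have "norm (f (\<lambda>x. of_real s * \<phi> x)) < 1"
      using e(2) by simp
    then have "s * norm (f \<phi>) < 1"
      using s by (simp add: f_scale[OF \<phi>] norm_mult)
    then show "norm (f \<phi>) \<le> 2 / e * K"
      using e(1) K by (simp add: s_def field_simps)
  qed
qed

section \<open>Taylor remainders\<close>

definition taylor_rem :: "real \<Rightarrow> nat \<Rightarrow> (real \<Rightarrow> complex) \<Rightarrow> real \<Rightarrow> complex" where
  "taylor_rem t M \<phi> y = \<phi> (t + y) - (\<Sum>k<M. D k \<phi> t * of_real y ^ k / fact k)"

text \<open>Differentiation lowers the order of a Taylor remainder by one. With truncated subtraction this
  also covers order 0, where the remainder is \<open>\<phi>\<close> itself, and so no case distinction arises when a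
  remainder is differentiated more often than its order.\<close>

lemma has_vector_derivative_taylor_rem:
  assumes "smooth \<phi>"
  shows "(taylor_rem t M \<phi> has_vector_derivative taylor_rem t (M - 1) (D 1 \<phi>) y) (at y)"
proof -
  have "((\<lambda>y. t + y) has_vector_derivative 1) (at y)"
    by (auto intro!: derivative_eq_intros)
  from vector_diff_chain_at[OF this, of \<phi> "D 1 \<phi> (t + y)"]
  have 1: "((\<lambda>y. \<phi> (t + y)) has_vector_derivative D 1 \<phi> (t + y)) (at y)"
    using smooth_has_vector_derivative[OF assms, of 0] by (simp add: o_def)
  have 2: "((\<lambda>y. \<Sum>k<M. D k \<phi> t * of_real y ^ k / fact k) has_vector_derivative
      (\<Sum>k<M - 1. D k (D 1 \<phi>) t * of_real y ^ k / fact k)) (at y)"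
  proof (cases M)
    case (Suc m)
    have mono: "((\<lambda>y. c * of_real y ^ Suc k / fact (Suc k)) has_vector_derivative
        c * of_real y ^ k / fact k) (at y)" for k and c :: complex
    proof -
      have "((\<lambda>z. c / fact (Suc k) * z ^ Suc k) has_field_derivative
          c / fact (Suc k) * (of_nat (Suc k) * of_real y ^ k)) (at (of_real y))"
        using DERIV_cmult[OF DERIV_power[OF DERIV_ident, of "Suc k" "of_real y" UNIV], of "c / fact (Suc k)"]
        by (simp del: fact_Suc of_nat_Suc power_Suc)
      moreover have "c / fact (Suc k) * (of_nat (Suc k) * of_real y ^ k) = c * of_real y ^ k / fact k"
        by (simp add: fact_Suc del: of_nat_Suc)
      ultimately have "((\<lambda>z. c / fact (Suc k) * z ^ Suc k) has_field_derivative
          c * of_real y ^ k / fact k) (at (of_real y))"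
        by simp
      from has_vector_derivative_real_field[OF this] show ?thesis by simp
    qed
    have "((\<lambda>y. \<Sum>k<m. D (Suc k) \<phi> t * of_real y ^ Suc k / fact (Suc k)) has_vector_derivative
      (\<Sum>k<m. D (Suc k) \<phi> t * of_real y ^ k / fact k)) (at y)"
      by (intro has_vector_derivative_sum mono)
    then have "((\<lambda>y. D 0 \<phi> t + (\<Sum>k<m. D (Suc k) \<phi> t * of_real y ^ Suc k / fact (Suc k)))
      has_vector_derivative (\<Sum>k<m. D (Suc k) \<phi> t * of_real y ^ k / fact k)) (at y)"
      using has_vector_derivative_add[OF has_vector_derivative_const] by (force simp only: add_0)
    then show ?thesis
      unfolding Suc sum.lessThan_Suc_shift by (simp add: D_D)
  qed auto
  show ?thesis
    using has_vector_derivative_diff[OF 1 2] by (simp add: taylor_rem_def[abs_def])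
qed

lemma
  assumes "smooth \<phi>"
  shows D_taylor_rem: "D n (taylor_rem t M \<phi>) = taylor_rem t (M - n) (D n \<phi>)"
    and smooth_taylor_rem: "smooth (taylor_rem t M \<phi>)"
proof -
  have "(taylor_rem t (M - n) (D n \<phi>) has_vector_derivative
      taylor_rem t (M - Suc n) (D (Suc n) \<phi>) x) (at x)" for n x
    using has_vector_derivative_taylor_rem[OF smooth_D[OF assms, of n], of t "M - n" x]
    by (simp add: D_D)
  then show "D n (taylor_rem t M \<phi>) = taylor_rem t (M - n) (D n \<phi>)" "smooth (taylor_rem t M \<phi>)"
    using D_eqI[of "\<lambda>n. taylor_rem t (M - n) (D n \<phi>)" "taylor_rem t M \<phi>"] by simp_all
qed

text \<open>A remainder of positive order vanishes at \<open>0\<close>, so the mean value inequality bounds it by \<open>\<bar>y\<bar>\<close>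
  times the bound for its derivative, which is a remainder of lower order.\<close>

lemma norm_taylor_rem_le:
  assumes "smooth \<phi>" "\<And>s. \<bar>s\<bar> \<le> \<bar>y\<bar> \<Longrightarrow> norm (D M \<phi> (t + s)) \<le> B"
  shows "norm (taylor_rem t M \<phi> y) \<le> B * \<bar>y\<bar> ^ M"
  using assms
proof (induction M arbitrary: \<phi> y)
  case 0
  then show ?case by (simp add: taylor_rem_def)
next
  case (Suc M)
  let ?S = "{-\<bar>y\<bar>..\<bar>y\<bar>}"
  have B: "B \<ge> 0"
    using Suc.prems(2)[of 0] norm_ge_zero[of "D (Suc M) \<phi> (t + 0)"] by linarith
  have "norm (taylor_rem t (Suc M) \<phi> y - taylor_rem t (Suc M) \<phi> 0) \<le> (B * \<bar>y\<bar> ^ M) * norm (y - 0)"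
  proof (rule differentiable_bound)
    show "convex ?S" by simp
    show "y \<in> ?S" "0 \<in> ?S" by auto
    fix x assume x: "x \<in> ?S"
    let ?d = "taylor_rem t M (D 1 \<phi>) x"
    show "(taylor_rem t (Suc M) \<phi> has_derivative (\<lambda>h. h *\<^sub>R ?d)) (at x within ?S)"
      using has_vector_derivative_taylor_rem[OF Suc.prems(1), of t "Suc M" x]
      by (simp add: has_vector_derivative_def has_derivative_at_withinI)
    have "norm ?d \<le> B * \<bar>x\<bar> ^ M"
    proof (rule Suc.IH)
      show "smooth (D 1 \<phi>)" by (rule smooth_D[OF Suc.prems(1)])
      fix s assume "\<bar>s\<bar> \<le> \<bar>x\<bar>"
      with x show "norm (D M (D 1 \<phi>) (t + s)) \<le> B"
        using Suc.prems(2)[of s] by (auto simp: D_D)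
    qed
    also have "\<dots> \<le> B * \<bar>y\<bar> ^ M"
      using x B by (intro mult_left_mono power_mono) auto
    finally show "onorm (\<lambda>h. h *\<^sub>R ?d) \<le> B * \<bar>y\<bar> ^ M"
      by (intro onorm_le) (simp add: mult.commute mult_left_mono)
  qed
  moreover have "taylor_rem t (Suc M) \<phi> 0 = 0"
    unfolding taylor_rem_def sum.lessThan_Suc_shift by simp
  ultimately show ?case by (simp add: mult_ac)
qed

text \<open>The decay \<open>a\<^sup>-\<^sup>M\<close> does not depend on the number \<open>n\<close> of derivatives: what
  Taylor's theorem loses when the order drops, the dilation returns.\<close>

lemma D_scaled_taylor_rem_le:
  assumes sm: "smooth \<phi>"
    and bd: "\<And>x. norm (D (M - n + n) \<phi> x) \<le> C * (1 + \<bar>x\<bar>) ^ g"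
    and C: "C \<ge> 0" and t: "\<bar>t\<bar> \<le> 1" and a: "a \<ge> 1"
  shows "norm (D n (\<lambda>x. taylor_rem t M \<phi> (x / a)) x) \<le> (1 / a) ^ M * C * (2 + \<bar>x\<bar>) ^ (M + g)"
proof -
  let ?c = "1 / a"
  have xa: "\<bar>x / a\<bar> \<le> \<bar>x\<bar>"
    using a mult_left_mono[of 1 a "\<bar>x\<bar>"] by (simp add: field_simps)
  have "D n (\<lambda>x. taylor_rem t M \<phi> (x / a)) x
      = of_real ?c ^ n * taylor_rem t (M - n) (D n \<phi>) (x / a)"
    using D_dilation[OF smooth_taylor_rem[OF sm, of t M], of n ?c] by (simp add: D_taylor_rem[OF sm])
  then have "norm (D n (\<lambda>x. taylor_rem t M \<phi> (x / a)) x)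
      = ?c ^ n * norm (taylor_rem t (M - n) (D n \<phi>) (x / a))"
    using a by (simp add: norm_mult norm_power norm_divide)
  also have "\<dots> \<le> ?c ^ n * (C * (2 + \<bar>x\<bar>) ^ g * \<bar>x / a\<bar> ^ (M - n))"
  proof (intro mult_left_mono norm_taylor_rem_le)
    fix s assume "\<bar>s\<bar> \<le> \<bar>x / a\<bar>"
    with xa t have "1 + \<bar>t + s\<bar> \<le> 2 + \<bar>x\<bar>" by linarith
    then have "C * (1 + \<bar>t + s\<bar>) ^ g \<le> C * (2 + \<bar>x\<bar>) ^ g"
      using C by (intro mult_left_mono power_mono) auto
    with bd[of "t + s"] show "norm (D (M - n) (D n \<phi>) (t + s)) \<le> C * (2 + \<bar>x\<bar>) ^ g"
      by (simp add: D_D)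
  qed (use a sm in \<open>auto intro: smooth_D\<close>)
  also have "\<dots> = ?c ^ (n + (M - n)) * (C * (2 + \<bar>x\<bar>) ^ g * \<bar>x\<bar> ^ (M - n))"
    using a by (simp add: power_add power_divide)
  also have "\<dots> \<le> ?c ^ M * (C * (2 + \<bar>x\<bar>) ^ g * (2 + \<bar>x\<bar>) ^ M)"
  proof (intro mult_mono mult_left_mono)
    show "?c ^ (n + (M - n)) \<le> ?c ^ M"
      using a by (intro power_decreasing) auto
    have "\<bar>x\<bar> ^ (M - n) \<le> (2 + \<bar>x\<bar>) ^ (M - n)"
      by (intro power_mono) auto
    also have "\<dots> \<le> (2 + \<bar>x\<bar>) ^ M"
      by (intro power_increasing) auto
    finally show "\<bar>x\<bar> ^ (M - n) \<le> (2 + \<bar>x\<bar>) ^ M" .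
  qed (use a C in auto)
  finally show ?thesis by (simp add: power_add mult_ac)
qed

text \<open>Hence \<open>f\<close> is \<open>O(a\<^sup>-\<^sup>M)\<close> on the dilated remainders, uniformly in the base point \<open>t \<in> [-1, 1]\<close>. The remainders
  belong to \<^const>\<open>Oc\<close> by the same bounds that estimate \<open>f\<close> on them.\<close>

lemma functional_scaled_taylor_rem_le:
  assumes "\<phi> \<in> Oc" "f \<in> Oc_dual"
  obtains C where "\<And>t a. \<bar>t\<bar> \<le> 1 \<Longrightarrow> a \<ge> 1 \<Longrightarrow>
    (\<lambda>x. taylor_rem t M \<phi> (x / a)) \<in> Oc \<and>
    norm (f (\<lambda>x. taylor_rem t M \<phi> (x / a))) \<le> C * (1 / a) ^ M"
proof -
  obtain g C where sm: "smooth \<phi>" and C: "\<And>n. C n \<ge> 0"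
    and bd: "\<And>n x. norm (D n \<phi> x) \<le> C n * (1 + \<bar>x\<bar>) ^ g"
    using Oc_bound[OF assms(1)] by metis
  let ?\<gamma> = "real (M + g)"
  have "f \<in> O_dual ?\<gamma>"
    using assms(2) by (auto simp: Oc_dual_eq_Inter)
  then obtain n B where B: "\<And>\<phi> K. \<phi> \<in> O_space ?\<gamma> \<Longrightarrow> K > 0 \<Longrightarrow>
    (\<And>\<alpha> x. \<alpha> \<le> n \<Longrightarrow> rho ?\<gamma> \<bar>x\<bar> * norm (D \<alpha> \<phi> x) \<le> K) \<Longrightarrow> norm (f \<phi>) \<le> B * K"
    by (metis O_dual_bounded)
  define K where "K = (\<Sum>k\<le>n. C (M - k + k)) * 3 ^ (M + g) + 1"
  have K: "K > 0"
    using C by (auto simp: K_def intro!: add_nonneg_pos mult_nonneg_nonneg sum_nonneg)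
  show ?thesis
  proof (rule that[of "B * K"])
    fix t a :: real assume t: "\<bar>t\<bar> \<le> 1" and a: "a \<ge> 1"
    let ?R = "\<lambda>x. taylor_rem t M \<phi> (x / a)"
    have le: "norm (D k ?R x) \<le> (1 / a) ^ M * C (M - k + k) * (2 + \<bar>x\<bar>) ^ (M + g)" for k x
      using D_scaled_taylor_rem_le[OF sm bd C t a] .
    have "smooth ?R"
      using smooth_dilation[OF smooth_taylor_rem[OF sm, of t M], of "1 / a"] by simp
    then have R: "?R \<in> O_space ?\<gamma>"
      using le by (rule O_spaceI)
    have "norm (f ?R) \<le> B * (K * (1 / a) ^ M)"
    proof (rule B[OF R])
      show "K * (1 / a) ^ M > 0" using K a by simp
      fix k x assume k: "k \<le> n"
      have "rho ?\<gamma> \<bar>x\<bar> * norm (D k ?R x)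
          \<le> rho ?\<gamma> \<bar>x\<bar> * ((1 / a) ^ M * C (M - k + k) * (2 + \<bar>x\<bar>) ^ (M + g))"
        by (intro mult_left_mono le) (simp add: rho_def)
      also have "\<dots> = (1 / a) ^ M * (C (M - k + k) * (rho ?\<gamma> \<bar>x\<bar> * (2 + \<bar>x\<bar>) ^ (M + g)))"
        by (simp add: mult_ac)
      also have "\<dots> \<le> (1 / a) ^ M * K"
      proof (rule mult_left_mono)
        have "C (M - k + k) * (rho ?\<gamma> \<bar>x\<bar> * (2 + \<bar>x\<bar>) ^ (M + g)) \<le> C (M - k + k) * 3 ^ (M + g)"
          using C by (intro mult_left_mono rho_mult_power_le) auto
        also have "\<dots> \<le> (\<Sum>k\<le>n. C (M - k + k)) * 3 ^ (M + g)"
          using C k by (intro mult_right_mono member_le_sum) auto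
        finally show "C (M - k + k) * (rho ?\<gamma> \<bar>x\<bar> * (2 + \<bar>x\<bar>) ^ (M + g)) \<le> K"
          by (simp add: K_def)
      qed (use a in auto)
      finally show "rho ?\<gamma> \<bar>x\<bar> * norm (D k ?R x) \<le> K * (1 / a) ^ M"
        by (simp add: mult_ac)
    qed
    with R show "?R \<in> Oc \<and> norm (f ?R) \<le> B * K * (1 / a) ^ M"
      by (auto simp: Oc_def mult_ac)
  qed
qed

section \<open>Moments and the expansion\<close>

lemma monomial_in_Oc: "(\<lambda>x. of_real x ^ m) \<in> Oc"
proof -
  define c :: "nat \<Rightarrow> complex" where "c n = (\<Prod>i<n. of_nat (m - i))" for n
  define G :: "nat \<Rightarrow> real \<Rightarrow> complex" where "G n x = c n * of_real x ^ (m - n)" for n x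
  have der: "(G n has_vector_derivative G (Suc n) x) (at x)" for n x
  proof -
    have "((\<lambda>z. c n * z ^ (m - n)) has_field_derivative G (Suc n) x) (at (of_real x))"
      by (rule derivative_eq_intros refl | simp add: G_def c_def)+
    from has_vector_derivative_real_field[OF this] show ?thesis
      by (simp add: G_def[abs_def])
  qed
  have G0: "G 0 = (\<lambda>x. of_real x ^ m)"
    by (simp add: G_def[abs_def] c_def)
  have "norm (D n (\<lambda>x. of_real x ^ m) x) \<le> norm (c n) * (2 + \<bar>x\<bar>) ^ m" for n x
  proof -
    have "\<bar>x\<bar> ^ (m - n) \<le> (2 + \<bar>x\<bar>) ^ (m - n)"
      by (intro power_mono) auto
    also have "\<dots> \<le> (2 + \<bar>x\<bar>) ^ m"
      by (intro power_increasing) auto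
    finally show ?thesis
      by (simp add: D_eqI(1)[OF G0 der] G_def norm_mult norm_power mult_left_mono)
  qed
  with D_eqI(2)[OF G0 der] have "(\<lambda>x. of_real x ^ m :: complex) \<in> O_space (real m)"
    by (rule O_spaceI)
  then show ?thesis by (auto simp: Oc_def)
qed

text \<open>Linearity of \<open>f\<close> is known only on \<^const>\<open>Oc\<close>, so membership is carried along in the induction.
  Applied to a Taylor remainder and its polynomial, this splits \<open>f\<close> of the dilated wavelet into
  error and partial sum.\<close>

lemma Oc_dual_add_polynomial:
  assumes "f \<in> Oc_dual" "\<phi> \<in> Oc"
  shows "f (\<lambda>x. \<phi> x + (\<Sum>k<M. c k * of_real x ^ k)) = f \<phi> + (\<Sum>k<M. c k * moment f k)"
    and "(\<lambda>x. \<phi> x + (\<Sum>k<M. c k * of_real x ^ k)) \<in> Oc"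
proof (induction M)
  case (Suc M)
  have eq: "(\<lambda>x. \<phi> x + (\<Sum>k<Suc M. c k * of_real x ^ k))
      = (\<lambda>x. 1 * (\<phi> x + (\<Sum>k<M. c k * of_real x ^ k)) + c M * of_real x ^ M)"
    by (simp add: add_ac)
  {
    case 1
    have lin: "linear_on_space Oc f"
      using assms(1) by (simp add: Oc_dual_def)
    show ?case
      unfolding eq
      using lin[unfolded linear_on_space_def, rule_format, OF Suc.IH(2) monomial_in_Oc]
      by (simp only: Suc.IH(1) moment_def) simp
  next
    case 2
    show ?case unfolding eq by (rule Oc_lincomb[OF Suc.IH(2) monomial_in_Oc])
  }
qed (use assms in auto)

theorem theorem4p2:
  fixes \<psi> :: "real \<Rightarrow> complex"
    and f :: "(real \<Rightarrow> complex) \<Rightarrow> complex"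
    and b :: real
  assumes "\<psi> \<in> Oc"
    and "f \<in> Oc_dual"
  shows "\<forall>N::nat.
    (\<lambda>a::real. of_real (sqrt a) * dilate a f (\<lambda>x. \<psi> (x - b / a))
        - (\<Sum>\<alpha>\<le>N. moment f \<alpha> * D \<alpha> \<psi> (- b / a) / (fact \<alpha> * of_real (a powr (real \<alpha> + 1 / 2)))))
      \<in> o[at_top](\<lambda>a. complex_of_real (a powr (- real N - 1 / 2)))"
proof
  fix N :: nat
  define M where "M = Suc N"
  let ?L = "\<lambda>a::real. of_real (sqrt a) * dilate a f (\<lambda>x. \<psi> (x - b / a))
        - (\<Sum>\<alpha>\<le>N. moment f \<alpha> * D \<alpha> \<psi> (- b / a) / (fact \<alpha> * of_real (a powr (real \<alpha> + 1 / 2))))"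
  obtain C where C: "\<And>t a. \<bar>t\<bar> \<le> 1 \<Longrightarrow> a \<ge> 1 \<Longrightarrow>
    (\<lambda>x. taylor_rem t M \<psi> (x / a)) \<in> Oc \<and>
    norm (f (\<lambda>x. taylor_rem t M \<psi> (x / a))) \<le> C * (1 / a) ^ M"
    using functional_scaled_taylor_rem_le[OF assms, where M = M] by blast
  \<comment> \<open>From \<open>\<bar>b\<bar>\<close> on, the base point \<open>-b/a\<close> stays in \<open>[-1, 1]\<close>; the exponent \<open>- N - 3/2\<close> is \<open>-1/2\<close> from the
    normalisation of the transform plus \<open>- M\<close> from the remainder.\<close>
  have bound: "norm (?L a) \<le> C * norm (complex_of_real (a powr (- real N - 3 / 2)))"
    if a: "a \<ge> max 1 \<bar>b\<bar>" for a
  proof -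
    have a1: "a \<ge> 1" and ab: "\<bar>- b / a\<bar> \<le> 1"
      using a by auto
    let ?t = "- b / a"
    let ?R = "\<lambda>x. taylor_rem ?t M \<psi> (x / a)"
    let ?c = "\<lambda>k. D k \<psi> ?t / (fact k * of_real a ^ k)"
    have R: "?R \<in> Oc" "norm (f ?R) \<le> C * (1 / a) ^ M"
      using C[OF ab a1] by auto
    have "(\<lambda>x. \<psi> (x / a - b / a)) = (\<lambda>x. ?R x + (\<Sum>k<M. ?c k * of_real x ^ k))"
      by (auto simp: taylor_rem_def power_divide mult_ac)
    then have f_eq: "f (\<lambda>x. \<psi> (x / a - b / a)) = f ?R + (\<Sum>k<M. ?c k * moment f k)"
      using Oc_dual_add_polynomial(1)[OF assms(2) R(1), of ?c M] by simp
    have half: "of_real (sqrt a) * (1 / of_real a) = complex_of_real (a powr (- 1 / 2))"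
    proof -
      have "sqrt a * (1 / a) = a powr (- 1 / 2)"
        using a1 by (simp add: powr_half_sqrt[symmetric] powr_minus field_simps powr_add[symmetric])
      then show ?thesis by (metis of_real_mult of_real_divide of_real_1)
    qed
    have term_eq: "moment f k * D k \<psi> ?t / (fact k * of_real (a powr (real k + 1 / 2)))
        = of_real (a powr (- 1 / 2)) * (?c k * moment f k)" for k
    proof -
      have "a powr (real k + 1 / 2) = a ^ k * a powr (1 / 2)"
        using a1 by (simp add: powr_add powr_realpow)
      moreover have "a powr (- 1 / 2) = 1 / a powr (1 / 2)"
        using a1 by (simp add: powr_minus_divide)
      ultimately show ?thesis by (simp add: mult_ac)
    qed
    have "?L a = of_real (a powr (- 1 / 2)) * f ?R"
      unfolding dilate_def mult.assoc[symmetric] half f_eq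
      by (simp add: term_eq[simplified] M_def lessThan_Suc_atMost sum_distrib_left algebra_simps)
    then have "norm (?L a) = a powr (- 1 / 2) * norm (f ?R)"
      by (simp add: norm_mult)
    also have "\<dots> \<le> a powr (- 1 / 2) * (C * (1 / a) ^ M)"
      by (intro mult_left_mono R) auto
    also have "(1 / a) ^ M = a powr (- real M)"
      using a1 by (simp add: powr_minus powr_realpow power_divide inverse_eq_divide)
    also have "a powr (- 1 / 2) * (C * a powr (- real M)) = C * a powr (- 1 / 2 + - real M)"
      by (simp only: powr_add) (simp add: mult_ac)
    also have "- 1 / 2 + - real M = - real N - 3 / 2"
      by (simp add: M_def)
    finally show ?thesis by simp
  qed
  have "?L \<in> O[at_top](\<lambda>a. complex_of_real (a powr (- real N - 3 / 2)))"
    using bound by (intro bigoI[of _ C] eventually_at_top_linorderI)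
  moreover have "(\<lambda>a. complex_of_real (a powr (- real N - 3 / 2)))
      \<in> o[at_top](\<lambda>a. complex_of_real (a powr (- real N - 1 / 2)))"
    by (subst landau_o.small.of_real_iff, subst powr_smallo_iff)
       (auto simp: filterlim_ident)
  ultimately show "?L \<in> o[at_top](\<lambda>a. complex_of_real (a powr (- real N - 1 / 2)))"
    by (rule landau_o.big_small_trans)
qed

end
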